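(* Let $N=\mathbb{Z}^l$, $N_{\mathbb{R}}=N\otimes_{\mathbb{Z}}\mathbb{R}=\mathbb{R}^l$, $M=\mathrm{Hom}_{\mathbb{Z}}(N,\mathbb{Z})$, $M_{\mathbb{R}}=M\otimes_{\mathbb{Z}}\mathbb{R}$, with natural pairing $\langle\cdot,\cdot\rangle$. Let $\Delta$ be a finite fan in $N$ and let $v_1,\ldots,v_r\in N$ be a set of vectors generating the one-dimensional cones of $\Delta$. Let $n=r+s$, let $\varphi=(\varphi_1,\ldots,\varphi_n)\in\mathbb{N}^r\times\mathbb{Z}^s$, and let $$\mathcal{P}_{\varphi}=\{u\in M_{\mathbb{R}}\mid \langle u,v_i\rangle\geq -\varphi_i\text{ for all } i=1,\ldots,r\}.$$ Then $\mathcal{P}_{\varphi}$ is a polytope (i.e. is bounded) if and only if $\Delta$ is not contained in a half-space.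
   Context: $\mathbb{N}$ includes $0$. A fan in $N$ is a collection of strongly convex rational polyhedral cones in $N_{\mathbb{R}}$, closed under taking faces and such that any two cones meet in a common face. That $v_1,\ldots,v_r$ generate the one-dimensional cones of $\Delta$ means that the set of one-dimensional cones of $\Delta$ is $\{\mathbb{R}_{\geq 0}v_i\mid i=1,\ldots,r\}$. For $0\neq u\in M_{\mathbb{R}}$, the half-space $H_u$ is $\{v\in N_{\mathbb{R}}\mid\langle u,v\rangle\geq 0\}$. The fan $\Delta$ is contained in a half-space if there is $0\neq u\in M_{\mathbb{R}}$ such that $\sigma\subseteq H_u$ for all $\sigma\in\Delta$. *)

theory Defs
  imports "HOL-Analysis.Analysis"
begin

text \<open>
  The type \<open>real ^ 'l\<close> serves both as \<open>N\<^sub>\<real>\<close> and, via the basis of \<open>M = Hom(N, \<int>)\<close> dual to the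
  standard basis of \<open>N = \<int>\<^sup>l\<close>, as \<open>M\<^sub>\<real>\<close>. Under this identification the natural pairing of
  \<open>u\<close> and \<open>v\<close> is the standard inner product \<open>u \<bullet> v\<close>.
\<close>

definition int_lattice :: "(real ^ 'l) set" where
  "int_lattice = {v. \<forall>i. v $ i \<in> \<int>}"

text \<open>
  Since \<open>convex_cone\<close> requires nonemptiness, the hull of the empty set is \<open>{0}\<close>, so the
  zero cone is included below.
\<close>

definition rational_polyhedral_cone :: "(real ^ 'l) set \<Rightarrow> bool" where
  "rational_polyhedral_cone \<sigma> \<longleftrightarrow>
     (\<exists>S. finite S \<and> S \<subseteq> int_lattice \<and> \<sigma> = convex_cone hull S)"

definition strongly_convex :: "(real ^ 'l) set \<Rightarrow> bool" where
  "strongly_convex \<sigma> \<longleftrightarrow> \<sigma> \<inter> uminus ` \<sigma> = {0}"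

text \<open>
  Faces in the sense of toric geometry: \<open>\<tau> = \<sigma> \<inter> u\<^sup>\<bottom>\<close> for some \<open>u\<close> in the dual cone of \<open>\<sigma>\<close>.
  The relations \<open>face_of\<close> and \<open>exposed_face_of\<close> are not used because they also count the
  empty set as a face.
\<close>

definition cone_face :: "(real ^ 'l) set \<Rightarrow> (real ^ 'l) set \<Rightarrow> bool" where
  "cone_face \<tau> \<sigma> \<longleftrightarrow> (\<exists>u. (\<forall>v\<in>\<sigma>. 0 \<le> u \<bullet> v) \<and> \<tau> = {v\<in>\<sigma>. u \<bullet> v = 0})"

definition fan :: "(real ^ 'l) set set \<Rightarrow> bool" where
  "fan \<Delta> \<longleftrightarrow>
     (\<forall>\<sigma>\<in>\<Delta>. rational_polyhedral_cone \<sigma> \<and> strongly_convex \<sigma>) \<and>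
     (\<forall>\<sigma>\<in>\<Delta>. \<forall>\<tau>. cone_face \<tau> \<sigma> \<longrightarrow> \<tau> \<in> \<Delta>) \<and>
     (\<forall>\<sigma>\<in>\<Delta>. \<forall>\<tau>\<in>\<Delta>. cone_face (\<sigma> \<inter> \<tau>) \<sigma> \<and> cone_face (\<sigma> \<inter> \<tau>) \<tau>)"

text \<open>
  The dimension of a cone is that of its linear span, and \<open>conic hull {v}\<close> is the ray
  \<open>\<real>\<^sub>\<ge>\<^sub>0 v\<close>. The family \<open>v\<close> is indexed by \<open>1, \<dots>, r\<close>; repetitions are allowed.
\<close>

definition generates_rays :: "nat \<Rightarrow> (nat \<Rightarrow> real ^ 'l) \<Rightarrow> (real ^ 'l) set set \<Rightarrow> bool" where
  "generates_rays r v \<Delta> \<longleftrightarrow> {\<sigma>\<in>\<Delta>. dim \<sigma> = 1} = (\<lambda>i. conic hull {v i}) ` {1..r}"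

definition halfspace :: "real ^ 'l \<Rightarrow> (real ^ 'l) set" where
  "halfspace u = {v. 0 \<le> u \<bullet> v}"

definition contained_in_halfspace :: "(real ^ 'l) set set \<Rightarrow> bool" where
  "contained_in_halfspace \<Delta> \<longleftrightarrow> (\<exists>u. u \<noteq> 0 \<and> (\<forall>\<sigma>\<in>\<Delta>. \<sigma> \<subseteq> halfspace u))"

text \<open>The set \<open>\<nat>\<^sup>r \<times> \<int>\<^sup>s\<close> of integer tuples with index set \<open>{1..r + s}\<close>.\<close>

definition mixed_tuples :: "nat \<Rightarrow> nat \<Rightarrow> (nat \<Rightarrow> int) set" where
  "mixed_tuples r s = (\<Pi>\<^sub>E i\<in>{1..r + s}. if i \<le> r then \<nat> else UNIV)"

definition weight_polyhedron ::
    "nat \<Rightarrow> (nat \<Rightarrow> real ^ 'l) \<Rightarrow> (nat \<Rightarrow> int) \<Rightarrow> (real ^ 'l) set" where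
  "weight_polyhedron r v \<phi> = {u. \<forall>i\<in>{1..r}. u \<bullet> v i \<ge> - real_of_int (\<phi> i)}"

end

theory Submission
  imports Defs
begin

text \<open>
  Both sides are decided by the same condition: whether some \<open>u \<noteq> 0\<close> satisfies \<open>0 \<le> u \<bullet> v i\<close>
  for all \<open>i\<close>.

  Such a \<open>u\<close> is exactly a nonzero direction in which the weight polyhedron recedes. As the
  entries \<open>\<phi> i\<close> with \<open>i \<le> r\<close> are natural numbers, the polyhedron contains the origin, so a
  receding direction makes it unbounded; without one, a compactness argument on the unit sphere
  bounds it (\<open>bounded_weight_polyhedron_iff\<close>).

  Such a \<open>u\<close> is also exactly a normal of a half-space containing the fan
  (\<open>fan_in_halfspace_iff\<close>). This rests on the fact that a strongly convex polyhedral cone is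
  generated by its one-dimensional faces. The cone is written as the cone over a polytope lying
  in an affine hyperplane off the origin. The polytope is the convex hull of its vertices, and
  since a vertex of a polytope is an exposed point, the ray over it is a face of the cone in the
  sense of \<open>cone_face\<close>. The fan contains these rays because it is closed under taking faces.
\<close>

section \<open>Rays of a pointed polyhedral cone\<close>

text \<open>
  A strongly convex cone stays convex after removing the origin, since a convex combination of
  nonzero points equal to \<open>0\<close> would exhibit a line in the cone. Hence the convex hull of the
  nonzero generators misses the origin and can be separated from it.
\<close>

lemma pointed_cone_positive_functional:
  fixes S :: "(real ^ 'l) set"
  assumes "finite S" and pointed: "strongly_convex (convex_cone hull S)"
  obtains w where "\<And>x. x \<in> S - {0} \<Longrightarrow> 0 < w \<bullet> x"
proof -
  let ?\<sigma> = "convex_cone hull S"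
  have "convex (?\<sigma> - {0})"
  proof (rule convexI)
    fix x y and a b :: real
    assume x: "x \<in> ?\<sigma> - {0}" and y: "y \<in> ?\<sigma> - {0}" and ab: "0 \<le> a" "0 \<le> b" "a + b = 1"
    have ax: "a *\<^sub>R x \<in> ?\<sigma>" and bY: "b *\<^sub>R y \<in> ?\<sigma>"
      using x y ab by (auto intro: convex_cone_hull_mul)
    have "a *\<^sub>R x + b *\<^sub>R y \<noteq> 0"
    proof
      assume sum0: "a *\<^sub>R x + b *\<^sub>R y = 0"
      then have "a *\<^sub>R x = - (b *\<^sub>R y)"
        by (simp add: eq_neg_iff_add_eq_0)
      with ax bY have "a *\<^sub>R x \<in> ?\<sigma> \<inter> uminus ` ?\<sigma>"
        by auto
      then have "a *\<^sub>R x = 0"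
        using pointed unfolding strongly_convex_def by auto
      moreover from this sum0 have "b *\<^sub>R y = 0"
        by (metis add_0)
      ultimately show False
        using x y ab by auto
    qed
    then show "a *\<^sub>R x + b *\<^sub>R y \<in> ?\<sigma> - {0}"
      using convex_cone_hull_add[OF ax bY] by simp
  qed
  then have "convex hull (S - {0}) \<subseteq> ?\<sigma> - {0}"
    by (intro hull_minimal) (auto intro: hull_inc)
  then have "0 \<notin> convex hull (S - {0})"
    by blast
  moreover have "closed (convex hull (S - {0}))"
    using \<open>finite S\<close> by (intro compact_imp_closed finite_imp_compact_convex_hull) simp
  ultimately obtain w b where "0 < b" and w: "\<forall>x \<in> convex hull (S - {0}). b < w \<bullet> x"
    using separating_hyperplane_closed_0[OF convex_convex_hull] by metis
  have "0 < w \<bullet> x" if "x \<in> S - {0}" for x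
    using w hull_inc[OF that, of convex] \<open>0 < b\<close> by fastforce
  then show thesis
    using that by blast
qed

text \<open>
  Rescaling the generators so that a positive functional takes the value \<open>1\<close> on them makes the
  cone the union of the rays through a polytope in an affine hyperplane.
\<close>

lemma pointed_cone_over_polytope:
  fixes S :: "(real ^ 'l) set"
  assumes "finite S" and "strongly_convex (convex_cone hull S)" and "convex_cone hull S \<noteq> {0}"
  obtains w Q where "polytope Q" "convex_cone hull S = conic hull Q" "\<And>y. y \<in> Q \<Longrightarrow> w \<bullet> y = 1"
proof -
  obtain w where w: "\<And>x. x \<in> S - {0} \<Longrightarrow> 0 < w \<bullet> x"
    using pointed_cone_positive_functional[OF assms(1,2)] by blast
  define T where "T = (\<lambda>x. inverse (w \<bullet> x) *\<^sub>R x) ` (S - {0})"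
  have "S \<subseteq> convex_cone hull T"
  proof
    fix x assume "x \<in> S"
    show "x \<in> convex_cone hull T"
    proof (cases "x = 0")
      case True
      then show ?thesis by (simp add: convex_cone_hull_contains_0)
    next
      case False
      then have "0 < w \<bullet> x" and "inverse (w \<bullet> x) *\<^sub>R x \<in> convex_cone hull T"
        using w \<open>x \<in> S\<close> by (auto simp: T_def intro: hull_inc)
      then show ?thesis
        using convex_cone_hull_mul[of "inverse (w \<bullet> x) *\<^sub>R x" T "w \<bullet> x"] by simp
    qed
  qed
  moreover have "T \<subseteq> convex_cone hull S"
  proof (unfold T_def, rule image_subsetI)
    fix x assume "x \<in> S - {0}"
    then have "x \<in> convex_cone hull S" and "0 \<le> inverse (w \<bullet> x)"
      using w[of x] by (auto intro: hull_inc)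
    then show "inverse (w \<bullet> x) *\<^sub>R x \<in> convex_cone hull S"
      by (rule convex_cone_hull_mul)
  qed
  ultimately have eq: "convex_cone hull S = convex_cone hull T"
    by (intro subset_antisym hull_minimal convex_cone_convex_cone_hull)
  have "T \<noteq> {}"
    using assms(3) eq convex_cone_hull_empty by metis
  have "polytope (convex hull T)"
    using \<open>finite S\<close> unfolding T_def by (intro polytope_convex_hull) simp
  moreover have "convex_cone hull S = conic hull (convex hull T)"
    using eq convex_cone_hull_separate_nonempty[OF \<open>T \<noteq> {}\<close>] by simp
  moreover have "convex hull T \<subseteq> {y. w \<bullet> y = 1}"
    using w by (intro hull_minimal convex_hyperplane) (force simp: T_def)
  ultimately show thesis
    using that by blast
qed

text \<open>
  A vertex \<open>x\<close> of the polytope is exposed by some inequality \<open>a \<bullet> y \<le> b\<close>. On the hyperplane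
  \<open>w \<bullet> y = 1\<close> this is the homogeneous inequality \<open>0 \<le> (b w - a) \<bullet> y\<close>, which cuts the ray
  through \<open>x\<close> out of the cone.
\<close>

lemma ray_over_vertex_cone_face:
  fixes Q :: "(real ^ 'l) set"
  assumes "polytope Q" and w: "\<And>y. y \<in> Q \<Longrightarrow> w \<bullet> y = 1" and x: "x extreme_point_of Q"
  shows "cone_face (conic hull {x}) (conic hull Q)"
proof -
  have "{x} exposed_face_of Q"
    using assms by (simp add: exposed_face_of_polyhedron polytope_imp_polyhedron face_of_singleton)
  then obtain a b where ab: "Q \<subseteq> {y. a \<bullet> y \<le> b}" "{x} = Q \<inter> {y. a \<bullet> y = b}"
    unfolding exposed_face_of_def by blast
  define c where "c = b *\<^sub>R w - a"
  have c: "c \<bullet> y = b - a \<bullet> y" if "y \<in> Q" for y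
    using w[OF that] by (simp add: c_def inner_diff_left)
  have c_nonneg: "0 \<le> c \<bullet> y" if "y \<in> Q" for y
    using ab(1) that c by auto
  have c_zero: "c \<bullet> y = 0 \<longleftrightarrow> y = x" if "y \<in> Q" for y
  proof -
    have "a \<bullet> y = b \<longleftrightarrow> y = x"
      using ab(2) that by blast
    then show ?thesis
      using c[OF that] by auto
  qed
  have xQ: "x \<in> Q"
    using ab(2) by blast
  have "0 \<le> c \<bullet> z" if "z \<in> conic hull Q" for z
    using that c_nonneg by (auto simp: conic_hull_explicit)
  moreover have "conic hull {x} = {z \<in> conic hull Q. c \<bullet> z = 0}"
  proof
    show "conic hull {x} \<subseteq> {z \<in> conic hull Q. c \<bullet> z = 0}"
      using xQ c_zero[OF xQ] by (auto simp: conic_hull_explicit)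
    show "{z \<in> conic hull Q. c \<bullet> z = 0} \<subseteq> conic hull {x}"
    proof clarify
      fix z assume "z \<in> conic hull Q" and z: "c \<bullet> z = 0"
      then obtain t y where t: "z = t *\<^sub>R y" "0 \<le> t" "y \<in> Q"
        by (auto simp: conic_hull_explicit)
      show "z \<in> conic hull {x}"
      proof (cases "t = 0")
        case True
        then show ?thesis using t by simp
      next
        case False
        then have "y = x" using z t c_zero by simp
        then show ?thesis using t by (auto simp: conic_hull_explicit)
      qed
    qed
  qed
  ultimately show ?thesis
    unfolding cone_face_def by blast
qed

lemma dim_ray:
  fixes x :: "real ^ 'l"
  assumes "x \<noteq> 0"
  shows "dim (conic hull {x}) = 1"
proof -
  have "conic hull {x} \<subseteq> span {x}"
    by (auto simp: conic_hull_explicit span_base span_scale)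
  then have "dim (conic hull {x}) \<le> dim {x}"
    by (metis dim_span dim_subset)
  moreover have "dim {x} \<le> dim (conic hull {x})"
    by (intro dim_subset hull_subset)
  ultimately show ?thesis
    using assms by simp
qed

text \<open>
  By the Krein-Milman theorem a pointed polyhedral cone is generated by the rays over the
  vertices of a polytope section, so a linear inequality need only be tested on the extremal
  rays.
\<close>

lemma pointed_cone_in_halfspaceI:
  fixes \<sigma> :: "(real ^ 'l) set"
  assumes "rational_polyhedral_cone \<sigma>" and "strongly_convex \<sigma>"
    and rays: "\<And>\<tau>. cone_face \<tau> \<sigma> \<Longrightarrow> dim \<tau> = 1 \<Longrightarrow> \<tau> \<subseteq> halfspace u"
  shows "\<sigma> \<subseteq> halfspace u"
proof (cases "\<sigma> = {0}")
  case True
  then show ?thesis by (simp add: halfspace_def)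
next
  case False
  obtain S where "finite S" and S: "\<sigma> = convex_cone hull S"
    using assms(1) unfolding rational_polyhedral_cone_def by blast
  then obtain w Q where "polytope Q" and \<sigma>: "\<sigma> = conic hull Q" and w: "\<And>y. y \<in> Q \<Longrightarrow> w \<bullet> y = 1"
    using pointed_cone_over_polytope assms(2) False by metis
  have "x \<in> halfspace u" if x: "x extreme_point_of Q" for x
  proof -
    have "cone_face (conic hull {x}) \<sigma>"
      using ray_over_vertex_cone_face[OF \<open>polytope Q\<close> w x] \<sigma> by simp
    moreover have "x \<noteq> 0"
      using w x by (force simp: extreme_point_of_def)
    ultimately have "conic hull {x} \<subseteq> halfspace u"
      using rays dim_ray by blast
    then show ?thesis
      using hull_inc[of x "{x}" conic] by blast
  qed
  then have "convex hull {x. x extreme_point_of Q} \<subseteq> halfspace u"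
    unfolding halfspace_def by (intro hull_minimal convex_halfspace_ge) auto
  then have "Q \<subseteq> halfspace u"
    using Krein_Milman_Minkowski \<open>polytope Q\<close> polytope_imp_compact polytope_imp_convex by metis
  then show ?thesis
    by (auto simp: \<sigma> conic_hull_explicit halfspace_def)
qed

text \<open>
  Faces of cones of a fan belong to the fan, so the extremal rays of its cones are among the
  rays spanned by the \<open>v i\<close>.
\<close>

lemma fan_in_halfspace_iff:
  assumes "fan \<Delta>" and gen: "generates_rays r v \<Delta>"
  shows "(\<forall>\<sigma>\<in>\<Delta>. \<sigma> \<subseteq> halfspace u) \<longleftrightarrow> (\<forall>i\<in>{1..r}. 0 \<le> u \<bullet> v i)"
proof
  assume L: "\<forall>\<sigma>\<in>\<Delta>. \<sigma> \<subseteq> halfspace u"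
  show "\<forall>i\<in>{1..r}. 0 \<le> u \<bullet> v i"
  proof
    fix i assume "i \<in> {1..r}"
    then have "conic hull {v i} \<in> \<Delta>"
      using gen unfolding generates_rays_def by blast
    then have "v i \<in> halfspace u"
      using L hull_inc[of "v i" "{v i}" conic] by blast
    then show "0 \<le> u \<bullet> v i"
      by (simp add: halfspace_def)
  qed
next
  assume R: "\<forall>i\<in>{1..r}. 0 \<le> u \<bullet> v i"
  show "\<forall>\<sigma>\<in>\<Delta>. \<sigma> \<subseteq> halfspace u"
  proof
    fix \<sigma> assume "\<sigma> \<in> \<Delta>"
    show "\<sigma> \<subseteq> halfspace u"
    proof (rule pointed_cone_in_halfspaceI)
      fix \<tau> assume "cone_face \<tau> \<sigma>" and "dim \<tau> = 1"
      then have "\<tau> \<in> {\<sigma>\<in>\<Delta>. dim \<sigma> = 1}"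
        using \<open>fan \<Delta>\<close> \<open>\<sigma> \<in> \<Delta>\<close> unfolding fan_def by blast
      then obtain i where "i \<in> {1..r}" "\<tau> = conic hull {v i}"
        using gen unfolding generates_rays_def by blast
      then show "\<tau> \<subseteq> halfspace u"
        using R by (auto simp: conic_hull_explicit halfspace_def)
    qed (use \<open>fan \<Delta>\<close> \<open>\<sigma> \<in> \<Delta>\<close> in \<open>auto simp: fan_def\<close>)
  qed
qed

section \<open>Boundedness of a system of linear inequalities\<close>

lemma polyhedron_weight_polyhedron: "polyhedron (weight_polyhedron r v \<phi>)"
proof -
  have "weight_polyhedron r v \<phi> = \<Inter> ((\<lambda>i. {u. v i \<bullet> u \<ge> - real_of_int (\<phi> i)}) ` {1..r})"
    by (auto simp: weight_polyhedron_def inner_commute)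
  then show ?thesis
    by (auto intro!: polyhedron_Inter polyhedron_halfspace_ge)
qed

text \<open>
  A nonzero \<open>u\<close> pairing nonnegatively with all \<open>v i\<close> spans a ray inside the polyhedron, because
  the polyhedron contains the origin. If there is none, the total violation
  \<open>\<Sum>i. max 0 (- (u \<bullet> v i))\<close> is positive on the unit sphere, so by compactness it is at least
  \<open>c * norm u\<close> for some \<open>c > 0\<close>; on the polyhedron it is at most \<open>\<Sum>i. \<phi> i\<close>.
\<close>

lemma bounded_weight_polyhedron_iff:
  fixes v :: "nat \<Rightarrow> real ^ 'l"
  assumes \<phi>: "\<And>i. i \<in> {1..r} \<Longrightarrow> 0 \<le> \<phi> i"
  shows "bounded (weight_polyhedron r v \<phi>) \<longleftrightarrow> \<not> (\<exists>u. u \<noteq> 0 \<and> (\<forall>i\<in>{1..r}. 0 \<le> u \<bullet> v i))"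
proof
  assume bdd: "bounded (weight_polyhedron r v \<phi>)"
  show "\<not> (\<exists>u. u \<noteq> 0 \<and> (\<forall>i\<in>{1..r}. 0 \<le> u \<bullet> v i))"
  proof clarify
    fix u :: "real ^ 'l"
    assume "u \<noteq> 0" and u: "\<forall>i\<in>{1..r}. 0 \<le> u \<bullet> v i"
    obtain B where B: "\<And>x. x \<in> weight_polyhedron r v \<phi> \<Longrightarrow> norm x \<le> B"
      using bdd unfolding bounded_iff by blast
    have "t *\<^sub>R u \<in> weight_polyhedron r v \<phi>" if "0 \<le> t" for t
      unfolding weight_polyhedron_def
    proof clarify
      fix i assume "i \<in> {1..r}"
      then have "0 \<le> t * (u \<bullet> v i)" and "0 \<le> \<phi> i"
        using u \<phi> that by auto
      then show "- real_of_int (\<phi> i) \<le> t *\<^sub>R u \<bullet> v i"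
        by simp
    qed
    from B[OF this] have "t * norm u \<le> B" if "0 \<le> t" for t
      using that by simp
    from this[of "(\<bar>B\<bar> + 1) / norm u"] show False
      using \<open>u \<noteq> 0\<close> by simp
  qed
next
  assume no: "\<not> (\<exists>u. u \<noteq> 0 \<and> (\<forall>i\<in>{1..r}. 0 \<le> u \<bullet> v i))"
  define g where "g u = (\<Sum>i\<in>{1..r}. max 0 (- (u \<bullet> v i)))" for u
  have g_pos: "0 < g u" if "u \<noteq> 0" for u
  proof -
    obtain i where "i \<in> {1..r}" "u \<bullet> v i < 0"
      using no \<open>u \<noteq> 0\<close> by force
    then show ?thesis
      unfolding g_def by (intro sum_pos2[of _ i]) auto
  qed
  have g_scale: "g (t *\<^sub>R u) = t * g u" if "0 \<le> t" for t u
    using that by (simp add: g_def sum_distrib_left max_mult_distrib_left)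
  have "continuous_on (sphere 0 1) g"
    unfolding g_def by (intro continuous_intros)
  moreover have "sphere (0 :: real ^ 'l) 1 \<noteq> {}"
    by simp
  ultimately obtain x :: "real ^ 'l" where x: "x \<in> sphere 0 1" "\<And>y. y \<in> sphere 0 1 \<Longrightarrow> g x \<le> g y"
    using continuous_attains_inf[OF compact_sphere] by metis
  have "x \<noteq> 0"
    using x(1) by auto
  have lower: "g x * norm u \<le> g u" for u
  proof (cases "u = 0")
    case True
    then show ?thesis by (simp add: g_def)
  next
    case False
    then have "g x \<le> g (u /\<^sub>R norm u)"
      by (intro x(2)) simp
    also have "\<dots> = g u / norm u"
      by (simp add: g_scale divide_inverse_commute)
    finally show ?thesis
      using False by (simp add: field_simps)
  qed
  have "norm u \<le> (\<Sum>i\<in>{1..r}. real_of_int (\<phi> i)) / g x" if u: "u \<in> weight_polyhedron r v \<phi>" for u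
  proof -
    have "g u \<le> (\<Sum>i\<in>{1..r}. real_of_int (\<phi> i))"
      unfolding g_def using u \<phi> by (intro sum_mono) (force simp: weight_polyhedron_def)
    then show ?thesis
      using lower[of u] g_pos[OF \<open>x \<noteq> 0\<close>] by (simp add: field_simps)
  qed
  then show "bounded (weight_polyhedron r v \<phi>)"
    unfolding bounded_iff by blast
qed

theorem proposition3p3:
  fixes \<Delta> :: "(real ^ 'l) set set"
    and v :: "nat \<Rightarrow> real ^ 'l"
    and \<phi> :: "nat \<Rightarrow> int"
    and r s :: nat
  assumes "fan \<Delta>" and "finite \<Delta>"
    and "v ` {1..r} \<subseteq> int_lattice"
    and "generates_rays r v \<Delta>"
    and "\<phi> \<in> mixed_tuples r s"
  shows "(polytope (weight_polyhedron r v \<phi>) \<longleftrightarrow> \<not> contained_in_halfspace \<Delta>) \<and>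
         (bounded (weight_polyhedron r v \<phi>) \<longleftrightarrow> \<not> contained_in_halfspace \<Delta>)"
proof -
  have "0 \<le> \<phi> i" if "i \<in> {1..r}" for i
  proof -
    have "\<phi> i \<in> (if i \<le> r then \<nat> else UNIV)"
      using assms(5) that PiE_mem[of \<phi> "{1..r + s}" "\<lambda>i. if i \<le> r then \<nat> else UNIV" i]
      by (simp add: mixed_tuples_def)
    then show ?thesis
      using that by (auto elim: Nats_cases)
  qed
  then have "bounded (weight_polyhedron r v \<phi>) \<longleftrightarrow> \<not> contained_in_halfspace \<Delta>"
    unfolding contained_in_halfspace_def fan_in_halfspace_iff[OF assms(1,4)]
    by (rule bounded_weight_polyhedron_iff)
  then show ?thesis
    by (simp add: polytope_eq_bounded_polyhedron polyhedron_weight_polyhedron)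
qed

end
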